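(* Let $\mathbb{P}$ be a frame and let $\Theta\subseteq\mathcal{P}(\mathbb{P})$ be an up-set (with respect to refinement). Then $\Theta$ is Picado-Pultr admissible if and only if $\Theta\subseteq\mathcal{C}_\leq(\mathbb{P})$ and, for every $p\in\mathbb{P}$, setting $Q=\{q\in\mathbb{P}:\exists C\in\Theta\ \forall c\in C\ (c\leq q\text{ or }c\leq p)\}$, $$\mathfrak{o}(p)=\bigvee_{q\in Q}\mathfrak{c}(q),$$ the join being taken in the lattice of sublocales of $\mathbb{P}$.
   Context: A frame is a complete lattice in which finite meets distribute over arbitrary joins; $p\rightarrow q$ denotes its Heyting implication. For $R,S\subseteq\mathbb{P}$, $R\leq S$ ($R$ refines $S$) means $\forall r\in R\ \exists s\in S\ (r\leq s)$; $\Theta\subseteq\mathcal{P}(\mathbb{P})$ is an up-set if $C\in\Theta$ and $C\leq D\subseteq\mathbb{P}$ imply $D\in\Theta$. A subset $C$ of a poset $\mathbb{P}$ is a $\leq$-cover if for all $p,q\in\mathbb{P}$: $p\leq q$ if and only if every $r\in\mathbb{P}$ with $r\leq p$ and $r\leq c$ for some $c\in C$ satisfies $r\leq q$. $\mathcal{C}_\leq(\mathbb{P})$ is the collection of all $\leq$-covers. $\Theta\subseteq\mathcal{P}(\mathbb{P})$ is Picado-Pultr admissible if for all $p,q\in\mathbb{P}$: $p\leq q\Leftrightarrow\forall C\in\Theta\ ((C\setminus\{p\})\cup\{q\}\in\mathcal{C}_\leq(\mathbb{P}))$. A sublocale of the frame $\mathbb{P}$ is a subset $S\subseteq\mathbb{P}$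 closed under arbitrary meets (including the empty meet $1$) and such that $a\rightarrow s\in S$ for all $a\in\mathbb{P}$, $s\in S$. Sublocales are ordered by inclusion, forming a complete lattice (a co-frame). The closed and open sublocales defined by $p$ are $\mathfrak{c}(p)=\{r\in\mathbb{P}:p\leq r\}$ and $\mathfrak{o}(p)=\{p\rightarrow q:q\in\mathbb{P}\}=\{q\in\mathbb{P}:p\rightarrow q=q\}$. *)

theory Defs
  imports Main
begin

section \<open>Covers and admissible collections in a poset\<close>

definition refines :: "'a::order set \<Rightarrow> 'a set \<Rightarrow> bool"
  where "refines R S \<longleftrightarrow> (\<forall>r\<in>R. \<exists>s\<in>S. r \<le> s)"

definition refinement_upset :: "'a::order set set \<Rightarrow> bool"
  where "refinement_upset \<Theta> \<longleftrightarrow> (\<forall>C\<in>\<Theta>. \<forall>D. refines C D \<longrightarrow> D \<in> \<Theta>)"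

definition le_cover :: "'a::order set \<Rightarrow> bool"
  where "le_cover C \<longleftrightarrow>
    (\<forall>p q. p \<le> q \<longleftrightarrow> (\<forall>r. r \<le> p \<and> (\<exists>c\<in>C. r \<le> c) \<longrightarrow> r \<le> q))"

definition le_covers :: "'a::order set set"
  where "le_covers = {C. le_cover C}"

definition picado_pultr_admissible :: "'a::order set set \<Rightarrow> bool"
  where "picado_pultr_admissible \<Theta> \<longleftrightarrow>
    (\<forall>p q. p \<le> q \<longleftrightarrow> (\<forall>C\<in>\<Theta>. (C - {p}) \<union> {q} \<in> le_covers))"


section \<open>Frames and their Heyting implication\<close>

text \<open>
  The library class \<open>complete_distrib_lattice\<close> requires complete distributivity, which is
  stronger than the frame law.
\<close>

class frame = complete_lattice +
  assumes inf_Sup_frame: "inf a (Sup B) = (SUP b\<in>B. inf a b)"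

definition himp :: "'a::frame \<Rightarrow> 'a \<Rightarrow> 'a"  (infixr \<open>\<rightarrow>\<^sub>H\<close> 60)
  where "p \<rightarrow>\<^sub>H q = Sup {r. inf r p \<le> q}"

lemma le_himp_iff: "r \<le> p \<rightarrow>\<^sub>H q \<longleftrightarrow> inf r p \<le> q"
proof
  assume "r \<le> p \<rightarrow>\<^sub>H q"
  then have "inf r p \<le> inf p (Sup {s. inf s p \<le> q})"
    unfolding himp_def by (simp add: inf.commute[of r p] le_infI2)
  also have "\<dots> \<le> q"
    unfolding inf_Sup_frame by (rule SUP_least) (simp add: inf.commute)
  finally show "inf r p \<le> q" .
next
  assume "inf r p \<le> q"
  then show "r \<le> p \<rightarrow>\<^sub>H q"
    unfolding himp_def by (simp add: Sup_upper)
qed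

lemma himp_himp: "p \<rightarrow>\<^sub>H (q \<rightarrow>\<^sub>H r) = inf p q \<rightarrow>\<^sub>H r"
proof -
  have "s \<le> p \<rightarrow>\<^sub>H (q \<rightarrow>\<^sub>H r) \<longleftrightarrow> s \<le> inf p q \<rightarrow>\<^sub>H r" for s
    by (simp add: le_himp_iff inf.assoc)
  then show ?thesis
    by (blast intro: antisym)
qed

lemma himp_Inf: "p \<rightarrow>\<^sub>H Inf A = (INF a\<in>A. p \<rightarrow>\<^sub>H a)"
proof (rule antisym)
  show "p \<rightarrow>\<^sub>H Inf A \<le> (INF a\<in>A. p \<rightarrow>\<^sub>H a)"
  proof (rule INF_greatest)
    fix a assume "a \<in> A"
    have "inf (p \<rightarrow>\<^sub>H Inf A) p \<le> Inf A"
      by (rule le_himp_iff[THEN iffD1]) (rule order_refl)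
    also have "\<dots> \<le> a"
      using \<open>a \<in> A\<close> by (rule Inf_lower)
    finally show "p \<rightarrow>\<^sub>H Inf A \<le> p \<rightarrow>\<^sub>H a"
      by (simp add: le_himp_iff)
  qed
  show "(INF a\<in>A. p \<rightarrow>\<^sub>H a) \<le> p \<rightarrow>\<^sub>H Inf A"
    unfolding le_himp_iff
    by (rule Inf_greatest) (simp add: INF_lower le_himp_iff[symmetric])
qed


section \<open>The complete lattice of sublocales\<close>

definition is_sublocale :: "'a::frame set \<Rightarrow> bool"
  where "is_sublocale S \<longleftrightarrow>
    (\<forall>A. A \<subseteq> S \<longrightarrow> Inf A \<in> S) \<and> (\<forall>a. \<forall>s\<in>S. a \<rightarrow>\<^sub>H s \<in> S)"

lemma is_sublocale_UNIV: "is_sublocale UNIV"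
  by (simp add: is_sublocale_def)

lemma is_sublocale_Inter:
  assumes "\<And>S. S \<in> \<S> \<Longrightarrow> is_sublocale S"
  shows "is_sublocale (\<Inter>\<S>)"
  using assms unfolding is_sublocale_def by (meson InterI InterD Inter_lower subset_trans)

typedef (overloaded) 'a frame_sublocale = "{S :: 'a::frame set. is_sublocale S}"
  morphisms carrier_of Sublocale
  using is_sublocale_UNIV by blast

setup_lifting type_definition_frame_sublocale

text \<open>
  Sublocales are ordered by inclusion and meets are intersections. Unlike meets, joins are not
  computed on the underlying sets: the union of sublocales need not be a sublocale, so the join
  is the intersection of all sublocales containing the union.
\<close>

instantiation frame_sublocale :: (frame) complete_lattice
begin

lift_definition less_eq_frame_sublocale :: "'a frame_sublocale \<Rightarrow> 'a frame_sublocale \<Rightarrow> bool" is "(\<subseteq>)" .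

lift_definition less_frame_sublocale :: "'a frame_sublocale \<Rightarrow> 'a frame_sublocale \<Rightarrow> bool" is "(\<subset>)" .

lift_definition Inf_frame_sublocale :: "'a frame_sublocale set \<Rightarrow> 'a frame_sublocale" is "Inter"
  by (rule is_sublocale_Inter)

lift_definition inf_frame_sublocale :: "'a frame_sublocale \<Rightarrow> 'a frame_sublocale \<Rightarrow> 'a frame_sublocale" is "(\<inter>)"
  by (auto simp: is_sublocale_def)

lift_definition top_frame_sublocale :: "'a frame_sublocale" is UNIV
  by (rule is_sublocale_UNIV)

definition Sup_frame_sublocale :: "'a frame_sublocale set \<Rightarrow> 'a frame_sublocale"
  where "Sup_frame_sublocale \<S> = Inf {T. \<forall>S\<in>\<S>. S \<le> T}"

definition sup_frame_sublocale :: "'a frame_sublocale \<Rightarrow> 'a frame_sublocale \<Rightarrow> 'a frame_sublocale"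
  where "sup_frame_sublocale S T = Inf {U. S \<le> U \<and> T \<le> U}"

definition bot_frame_sublocale :: "'a frame_sublocale"
  where "bot_frame_sublocale = Inf UNIV"

instance
proof
  fix S T U :: "'a frame_sublocale" and \<S> :: "'a frame_sublocale set"
  show "S < T \<longleftrightarrow> S \<le> T \<and> \<not> T \<le> S"
    by transfer blast
  show "S \<le> S"
    by transfer blast
  show "S \<le> T \<Longrightarrow> T \<le> U \<Longrightarrow> S \<le> U"
    by transfer blast
  show "S \<le> T \<Longrightarrow> T \<le> S \<Longrightarrow> S = T"
    by transfer blast
  show "inf S T \<le> S" "inf S T \<le> T"
    by (transfer, blast)+
  show "S \<le> T \<Longrightarrow> S \<le> U \<Longrightarrow> S \<le> inf T U"
    by transfer blast
  have Inf_low: "Inf \<T> \<le> V" if "V \<in> \<T>" for V :: "'a frame_sublocale" and \<T>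
    using that by transfer blast
  have Inf_great: "V \<le> Inf \<T>" if "\<And>W. W \<in> \<T> \<Longrightarrow> V \<le> W"
    for V :: "'a frame_sublocale" and \<T>
    using that by transfer blast
  show "S \<in> \<S> \<Longrightarrow> Inf \<S> \<le> S"
    by (rule Inf_low)
  show "(\<And>W. W \<in> \<S> \<Longrightarrow> S \<le> W) \<Longrightarrow> S \<le> Inf \<S>"
    by (rule Inf_great)
  show "S \<le> sup S T" "T \<le> sup S T"
    by (auto simp: sup_frame_sublocale_def intro: Inf_great)
  show "T \<le> S \<Longrightarrow> U \<le> S \<Longrightarrow> sup T U \<le> S"
    by (auto simp: sup_frame_sublocale_def intro: Inf_low)
  show "S \<in> \<S> \<Longrightarrow> S \<le> Sup \<S>"
    by (auto simp: Sup_frame_sublocale_def intro: Inf_great)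
  show "(\<And>W. W \<in> \<S> \<Longrightarrow> W \<le> S) \<Longrightarrow> Sup \<S> \<le> S"
    by (auto simp: Sup_frame_sublocale_def intro: Inf_low)
  show "Inf {} = (top :: 'a frame_sublocale)"
    by transfer simp
  show "Sup {} = (bot :: 'a frame_sublocale)"
    by (simp add: Sup_frame_sublocale_def bot_frame_sublocale_def)
qed

end

lift_definition closed_sublocale :: "'a::frame \<Rightarrow> 'a frame_sublocale"
  is "\<lambda>p. {r. p \<le> r}"
  unfolding is_sublocale_def
  by (simp add: subset_iff le_Inf_iff le_himp_iff le_infI1)

lift_definition open_sublocale :: "'a::frame \<Rightarrow> 'a frame_sublocale"
  is "\<lambda>p. {p \<rightarrow>\<^sub>H q |q. True}"
proof -
  fix p :: 'a
  have "Inf A \<in> {p \<rightarrow>\<^sub>H q |q. True}" if "A \<subseteq> {p \<rightarrow>\<^sub>H q |q. True}" for A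
  proof -
    from that have "A \<subseteq> range ((\<rightarrow>\<^sub>H) p)"
      by auto
    then obtain B where "A = (\<rightarrow>\<^sub>H) p ` B"
      by (rule subset_imageE)
    then have "Inf A = p \<rightarrow>\<^sub>H Inf B"
      by (simp only: himp_Inf)
    then show ?thesis
      by blast
  qed
  moreover have "a \<rightarrow>\<^sub>H (p \<rightarrow>\<^sub>H q) = p \<rightarrow>\<^sub>H (a \<rightarrow>\<^sub>H q)" for a q
    by (simp add: himp_himp inf.commute)
  ultimately show "is_sublocale {p \<rightarrow>\<^sub>H q |q. True}"
    unfolding is_sublocale_def by blast
qed

lemma carrier_of_open_sublocale_fixpoints: "carrier_of (open_sublocale p) = {q. p \<rightarrow>\<^sub>H q = q}"
proof -
  have "p \<rightarrow>\<^sub>H (p \<rightarrow>\<^sub>H q) = p \<rightarrow>\<^sub>H q" for q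
    by (simp add: himp_himp)
  then show ?thesis
    unfolding open_sublocale.rep_eq by (metis (lifting))
qed

end

theory Submission
  imports Defs
begin

text \<open>
  Three observations turn both sides into elementary conditions on binary joins.

  First, in a frame a \<open>\<le>\<close>-cover is just a set with join \<open>\<top>\<close> (\<open>le_cover_iff_Sup_eq_top\<close>).
  Secondly, as \<open>\<Theta>\<close> is an up-set, only its members of the form \<open>{p, q}\<close> matter: a member of \<open>\<Theta>\<close> splits into
  the elements below \<open>p\<close> and the rest, so the index set of the join consists of the \<open>q\<close> with
  \<open>{p, q} \<in> \<Theta>\<close> (\<open>dominated_member_iff_pair\<close>), and admissibility says that \<open>\<Theta>\<close> consists of covers
  and that \<open>p \<le> q\<close> holds whenever \<open>q\<close> joins to \<open>\<top>\<close> with every \<open>r\<close> such that \<open>{p, r} \<in> \<Theta>\<close>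
  (\<open>admissible_iff_pairs\<close>).
  Thirdly, \<open>x\<close> lies in the join of the closed sublocales of the elements of \<open>Q\<close> if and only if
  \<open>x\<close> is the meet of all \<open>x \<squnion> q\<close> with \<open>q \<in> Q\<close> (\<open>mem_SUP_closed_sublocale_iff\<close>).

  If \<open>\<Theta>\<close> consists of covers and \<open>{p, r} \<in> \<Theta>\<close>, then \<open>p \<squnion> r = \<top>\<close>, so the closed sublocale of \<open>r\<close> is
  contained in the open sublocale of \<open>p\<close>; hence only the inclusion of the open sublocale in the
  join is at stake. Suppose that it holds and that \<open>q \<squnion> r = \<top>\<close> for all these \<open>r\<close>. Then
  \<open>x = p \<rightarrow> q\<close> is in the open sublocale and above \<open>q\<close>, so \<open>x\<close> is a meet of copies of \<open>\<top>\<close>, that is,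
  \<open>p \<le> q\<close>. Conversely, suppose that \<open>\<Theta>\<close> is admissible, let \<open>x = p \<rightarrow> x\<close>, and let \<open>y\<close> be below all
  the \<open>x \<squnion> r\<close>. To obtain \<open>y \<le> x\<close>, it is enough to have \<open>p \<sqinter> y \<le> x\<close>, and this follows from
  admissibility at the element \<open>p \<sqinter> y\<close> rather than at \<open>p\<close>.
\<close>

section \<open>Frames and covers\<close>

lemma inf_sup_le_frame:
  fixes a b c d :: "'a::frame"
  assumes "inf a b \<le> d" and "inf a c \<le> d"
  shows "inf a (sup b c) \<le> d"
proof -
  have "b \<le> a \<rightarrow>\<^sub>H d" and "c \<le> a \<rightarrow>\<^sub>H d"
    using assms by (simp_all add: le_himp_iff inf.commute)
  then have "sup b c \<le> a \<rightarrow>\<^sub>H d"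
    by (rule le_supI)
  then show ?thesis
    by (simp only: le_himp_iff inf.commute[of a])
qed

text \<open>
  By the frame law, the right-hand side of the cover condition says \<open>p \<sqinter> \<Squnion>C \<le> q\<close>. This is
  equivalent to \<open>p \<le> q\<close> for all \<open>p\<close> and \<open>q\<close> exactly if \<open>\<Squnion>C = \<top>\<close>; the decisive instance is
  \<open>p = \<top>\<close>, \<open>q = \<Squnion>C\<close>.
\<close>

lemma le_cover_iff_Sup_eq_top:
  fixes C :: "'a::frame set"
  shows "le_cover C \<longleftrightarrow> Sup C = top"
proof -
  have local_le: "(\<forall>r. r \<le> p \<and> (\<exists>c\<in>C. r \<le> c) \<longrightarrow> r \<le> q) \<longleftrightarrow> inf p (Sup C) \<le> q" for p q :: 'a
  proof -
    have "(\<forall>r. r \<le> p \<and> (\<exists>c\<in>C. r \<le> c) \<longrightarrow> r \<le> q) \<longleftrightarrow> (\<forall>c\<in>C. inf p c \<le> q)"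
      by (meson inf_le1 inf_le2 le_inf_iff order_trans)
    also have "\<dots> \<longleftrightarrow> inf p (Sup C) \<le> q"
      by (simp add: inf_Sup_frame SUP_le_iff)
    finally show ?thesis .
  qed
  show ?thesis
  proof
    assume "le_cover C"
    then have "top \<le> Sup C \<longleftrightarrow> inf top (Sup C) \<le> Sup C"
      unfolding le_cover_def local_le by blast
    then show "Sup C = top"
      by (simp add: top_unique)
  next
    assume "Sup C = top"
    then show "le_cover C"
      by (simp add: le_cover_def local_le)
  qed
qed


section \<open>Sublocales\<close>

text \<open>
  The join is at least \<open>{x. x = (\<Sqinter>q\<in>Q. x \<squnion> q)}\<close>, because each \<open>x \<squnion> q\<close> lies in the closed sublocale
  of \<open>q\<close> and sublocales are closed under meets. It is no larger, because this set is itself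
  a sublocale that contains every closed sublocale of an element of \<open>Q\<close>.
\<close>

lemma mem_SUP_closed_sublocale_iff:
  fixes x :: "'a::frame"
  shows "x \<in> carrier_of (SUP q\<in>Q. closed_sublocale q) \<longleftrightarrow> (INF q\<in>Q. sup x q) \<le> x"
    (is "_ \<in> carrier_of ?J \<longleftrightarrow> _")
proof
  define T where "T = {x::'a. \<forall>y. (\<forall>q\<in>Q. y \<le> sup x q) \<longrightarrow> y \<le> x}"
  have "is_sublocale T"
    unfolding is_sublocale_def
  proof (intro conjI allI impI ballI)
    fix A assume "A \<subseteq> T"
    show "Inf A \<in> T"
      unfolding T_def
    proof (intro CollectI allI impI)
      fix y assume y: "\<forall>q\<in>Q. y \<le> sup (Inf A) q"
      have "y \<le> a" if "a \<in> A" for a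
      proof -
        have "sup (Inf A) q \<le> sup a q" for q
          using that by (intro sup_mono Inf_lower order_refl)
        then have "\<forall>q\<in>Q. y \<le> sup a q"
          using y order_trans by blast
        then show ?thesis
          using that \<open>A \<subseteq> T\<close> unfolding T_def by blast
      qed
      then show "y \<le> Inf A"
        by (rule Inf_greatest)
    qed
  next
    fix a s assume "s \<in> T"
    show "a \<rightarrow>\<^sub>H s \<in> T"
      unfolding T_def
    proof (intro CollectI allI impI)
      fix y assume y: "\<forall>q\<in>Q. y \<le> sup (a \<rightarrow>\<^sub>H s) q"
      have "inf y a \<le> sup s q" if "q \<in> Q" for q
      proof -
        have "inf (a \<rightarrow>\<^sub>H s) a \<le> s"
          by (simp flip: le_himp_iff)
        then have "a \<rightarrow>\<^sub>H s \<le> a \<rightarrow>\<^sub>H sup s q" and "q \<le> a \<rightarrow>\<^sub>H sup s q"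
          by (simp_all add: le_himp_iff le_supI1 le_infI1)
        then have "sup (a \<rightarrow>\<^sub>H s) q \<le> a \<rightarrow>\<^sub>H sup s q"
          by simp
        then show ?thesis
          using y that by (meson le_himp_iff order_trans)
      qed
      then have "inf y a \<le> s"
        using \<open>s \<in> T\<close> by (simp add: T_def)
      then show "y \<le> a \<rightarrow>\<^sub>H s"
        by (simp add: le_himp_iff)
    qed
  qed
  then have T: "carrier_of (Sublocale T) = T"
    by (simp add: Sublocale_inverse)
  have "?J \<le> Sublocale T"
  proof (rule SUP_least)
    fix q assume "q \<in> Q"
    then have "x \<in> T" if "q \<le> x" for x
      using that by (auto simp: T_def sup_absorb1)
    then show "closed_sublocale q \<le> Sublocale T"
      by (auto simp: less_eq_frame_sublocale.rep_eq closed_sublocale.rep_eq T)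
  qed
  then have J_le: "carrier_of ?J \<subseteq> T"
    by (simp add: less_eq_frame_sublocale.rep_eq T)
  assume "x \<in> carrier_of ?J"
  with J_le have "x \<in> T" ..
  moreover have "\<forall>q\<in>Q. (INF q\<in>Q. sup x q) \<le> sup x q"
    by (simp add: INF_lower)
  ultimately show "(INF q\<in>Q. sup x q) \<le> x"
    by (simp add: T_def)
next
  assume "(INF q\<in>Q. sup x q) \<le> x"
  then have x: "x = (INF q\<in>Q. sup x q)"
    by (intro antisym INF_greatest sup_ge1)
  have "sup x ` Q \<subseteq> carrier_of ?J"
  proof (rule image_subsetI)
    fix q assume "q \<in> Q"
    then have "closed_sublocale q \<le> ?J"
      by (rule SUP_upper)
    then show "sup x q \<in> carrier_of ?J"
      by (auto simp: less_eq_frame_sublocale.rep_eq closed_sublocale.rep_eq)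
  qed
  moreover have "is_sublocale (carrier_of ?J)"
    using carrier_of by simp
  ultimately have "(INF q\<in>Q. sup x q) \<in> carrier_of ?J"
    by (simp only: is_sublocale_def)
  with x show "x \<in> carrier_of ?J"
    by simp
qed

lemma closed_sublocale_le_open_sublocale:
  fixes p r :: "'a::frame"
  assumes "sup p r = top"
  shows "closed_sublocale r \<le> open_sublocale p"
proof -
  have "p \<rightarrow>\<^sub>H x = x" if "r \<le> x" for x
  proof (rule antisym)
    have "inf (p \<rightarrow>\<^sub>H x) p \<le> x"
      by (simp flip: le_himp_iff)
    moreover have "inf (p \<rightarrow>\<^sub>H x) r \<le> x"
      using that by (rule le_infI2)
    ultimately have "inf (p \<rightarrow>\<^sub>H x) (sup p r) \<le> x"
      by (rule inf_sup_le_frame)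
    then show "p \<rightarrow>\<^sub>H x \<le> x"
      by (simp add: assms)
    show "x \<le> p \<rightarrow>\<^sub>H x"
      by (simp add: le_himp_iff)
  qed
  then show ?thesis
    by (auto simp: less_eq_frame_sublocale.rep_eq closed_sublocale.rep_eq
        carrier_of_open_sublocale_fixpoints)
qed


section \<open>Admissible up-sets\<close>

lemma dominated_member_iff_pair:
  fixes \<Theta> :: "'a::order set set"
  assumes "refinement_upset \<Theta>"
  shows "(\<exists>C\<in>\<Theta>. \<forall>c\<in>C. c \<le> q \<or> c \<le> p) \<longleftrightarrow> {p, q} \<in> \<Theta>"
proof
  assume "\<exists>C\<in>\<Theta>. \<forall>c\<in>C. c \<le> q \<or> c \<le> p"
  then obtain C where "C \<in> \<Theta>" and "refines C {p, q}"
    by (auto simp: refines_def)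
  then show "{p, q} \<in> \<Theta>"
    using assms by (auto simp: refinement_upset_def)
next
  assume "{p, q} \<in> \<Theta>"
  then show "\<exists>C\<in>\<Theta>. \<forall>c\<in>C. c \<le> q \<or> c \<le> p"
    by (rule rev_bexI) simp
qed

text \<open>
  Given \<open>p\<close> and \<open>C \<in> \<Theta>\<close>, the element \<open>r = \<Squnion>(C - {p})\<close> satisfies \<open>{p, r} \<in> \<Theta>\<close>, and \<open>(C - {p}) \<union> {q}\<close>
  is a cover if and only if \<open>q \<squnion> r = \<top>\<close>. So the exchange condition for all members of \<open>\<Theta>\<close>
  amounts to that for pairs.
\<close>

lemma exchange_covers_iff_pairs:
  fixes \<Theta> :: "'a::frame set set"
  assumes up: "refinement_upset \<Theta>"
  shows "(\<forall>C\<in>\<Theta>. (C - {p}) \<union> {q} \<in> le_covers) \<longleftrightarrow> (\<forall>r. {p, r} \<in> \<Theta> \<longrightarrow> sup q r = top)"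
proof -
  have cover: "(C - {p}) \<union> {q} \<in> le_covers \<longleftrightarrow> sup q (Sup (C - {p})) = top" for C
    by (simp add: le_covers_def le_cover_iff_Sup_eq_top)
  show ?thesis
    unfolding cover
  proof (intro iffI allI impI ballI)
    fix r assume "\<forall>C\<in>\<Theta>. sup q (Sup (C - {p})) = top" and "{p, r} \<in> \<Theta>"
    then have "top = sup q (Sup ({p, r} - {p}))"
      by (metis (no_types))
    \<comment> \<open>Only an inequality, since \<open>r\<close> might be \<open>p\<close>.\<close>
    also have "\<dots> \<le> sup q r"
      by (intro sup_mono order_refl Sup_least) auto
    finally show "sup q r = top"
      by (simp add: top_unique)
  next
    fix C assume pairs: "\<forall>r. {p, r} \<in> \<Theta> \<longrightarrow> sup q r = top" and "C \<in> \<Theta>"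
    have "\<forall>c\<in>C. c \<le> Sup (C - {p}) \<or> c \<le> p"
      by (auto intro: Sup_upper)
    then have "{p, Sup (C - {p})} \<in> \<Theta>"
      using \<open>C \<in> \<Theta>\<close> dominated_member_iff_pair[OF up] by blast
    with pairs show "sup q (Sup (C - {p})) = top"
      by blast
  qed
qed

text \<open>
  Reflexivity of \<open>\<le>\<close> at \<open>\<bottom>\<close> makes every \<open>C \<union> {\<bottom>}\<close> with \<open>C \<in> \<Theta>\<close> a cover, and hence \<open>C\<close> itself.
  Once all members of \<open>\<Theta>\<close> are covers, the implication from \<open>p \<le> q\<close> is automatic.
\<close>

lemma admissible_iff_pairs:
  fixes \<Theta> :: "'a::frame set set"
  assumes up: "refinement_upset \<Theta>"
  shows "picado_pultr_admissible \<Theta> \<longleftrightarrow>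
    \<Theta> \<subseteq> le_covers \<and> (\<forall>p q. (\<forall>r. {p, r} \<in> \<Theta> \<longrightarrow> sup q r = top) \<longrightarrow> p \<le> q)"
proof -
  have "\<Theta> \<subseteq> le_covers" if adm: "picado_pultr_admissible \<Theta>"
  proof
    fix C assume "C \<in> \<Theta>"
    have "\<forall>C\<in>\<Theta>. (C - {bot}) \<union> {bot} \<in> le_covers"
      using adm unfolding picado_pultr_admissible_def by (meson order_refl)
    then have "(C - {bot}) \<union> {bot} \<in> le_covers"
      using \<open>C \<in> \<Theta>\<close> ..
    then show "C \<in> le_covers"
      by (simp add: le_covers_def le_cover_iff_Sup_eq_top)
  qed
  moreover have "sup q r = top" if "\<Theta> \<subseteq> le_covers" "p \<le> q" "{p, r} \<in> \<Theta>" for p q r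
  proof -
    have "sup p r = top"
      using that by (auto simp: le_covers_def le_cover_iff_Sup_eq_top)
    moreover have "sup p r \<le> sup q r"
      using \<open>p \<le> q\<close> by (rule sup_mono) simp
    ultimately show ?thesis
      by (simp add: top_unique)
  qed
  ultimately show ?thesis
    unfolding picado_pultr_admissible_def exchange_covers_iff_pairs[OF up] by blast
qed

theorem theorem9p3:
  fixes \<Theta> :: "'a::frame set set"
  assumes "refinement_upset \<Theta>"
  shows "picado_pultr_admissible \<Theta> \<longleftrightarrow>
    \<Theta> \<subseteq> le_covers \<and>
    (\<forall>p::'a. open_sublocale p =
      (SUP q\<in>{q. \<exists>C\<in>\<Theta>. \<forall>c\<in>C. c \<le> q \<or> c \<le> p}. closed_sublocale q))"
proof -
  let ?J = "\<lambda>p. SUP q\<in>{q. {p, q} \<in> \<Theta>}. closed_sublocale q"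
  have "(\<forall>p q. (\<forall>r. {p, r} \<in> \<Theta> \<longrightarrow> sup q r = top) \<longrightarrow> p \<le> q) \<longleftrightarrow> (\<forall>p. open_sublocale p = ?J p)"
    if covers: "\<Theta> \<subseteq> le_covers"
  proof -
    have pair_top: "sup p r = top" if "{p, r} \<in> \<Theta>" for p r
      using covers that by (auto simp: le_covers_def le_cover_iff_Sup_eq_top)
    show ?thesis
    proof (intro iffI allI impI)
      fix p
      assume adm: "\<forall>p q. (\<forall>r. {p, r} \<in> \<Theta> \<longrightarrow> sup q r = top) \<longrightarrow> p \<le> q"
      show "open_sublocale p = ?J p"
      proof (rule antisym)
        show "?J p \<le> open_sublocale p"
          by (auto intro!: SUP_least closed_sublocale_le_open_sublocale pair_top)
        have "x \<in> carrier_of (?J p)" if "p \<rightarrow>\<^sub>H x = x" for x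
        proof -
          define y where "y = (INF r\<in>{r. {p, r} \<in> \<Theta>}. sup x r)"
          have "sup x r = top" if r: "{inf p y, r} \<in> \<Theta>" for r
          proof -
            \<comment> \<open>Lowering \<open>p\<close> to \<open>p \<sqinter> y\<close> admits no new \<open>r\<close>, so \<open>y\<close> is still below every \<open>x \<squnion> r\<close>, while
              \<open>r\<close> now joins to \<open>\<top>\<close> with \<open>p \<sqinter> y\<close>.\<close>
            have "refines {inf p y, r} {p, r}"
              by (auto simp: refines_def)
            with r assms have "{p, r} \<in> \<Theta>"
              unfolding refinement_upset_def by blast
            then have "y \<le> sup x r"
              unfolding y_def by (intro INF_lower) simp
            then have "sup (inf p y) r \<le> sup x r"
              by (simp add: le_infI2)
            with pair_top[OF r] show ?thesis
              by (simp add: top_unique)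
          qed
          with adm have "inf p y \<le> x"
            by blast
          then have "y \<le> p \<rightarrow>\<^sub>H x"
            by (simp add: le_himp_iff inf.commute)
          with that show ?thesis
            by (simp add: mem_SUP_closed_sublocale_iff y_def)
        qed
        then show "open_sublocale p \<le> ?J p"
          by (auto simp: less_eq_frame_sublocale.rep_eq carrier_of_open_sublocale_fixpoints)
      qed
    next
      fix p q
      assume join: "\<forall>p. open_sublocale p = ?J p"
        and q: "\<forall>r. {p, r} \<in> \<Theta> \<longrightarrow> sup q r = top"
      have "p \<rightarrow>\<^sub>H q \<in> carrier_of (open_sublocale p)"
        by (auto simp: open_sublocale.rep_eq)
      then have "p \<rightarrow>\<^sub>H q \<in> carrier_of (?J p)"
        by (simp only: join[rule_format])
      then have "(INF r\<in>{r. {p, r} \<in> \<Theta>}. sup (p \<rightarrow>\<^sub>H q) r) \<le> p \<rightarrow>\<^sub>H q"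
        by (simp only: mem_SUP_closed_sublocale_iff)
      moreover have "top \<le> sup (p \<rightarrow>\<^sub>H q) r" if "{p, r} \<in> \<Theta>" for r
      proof -
        have "q \<le> p \<rightarrow>\<^sub>H q"
          by (simp add: le_himp_iff)
        then have "sup q r \<le> sup (p \<rightarrow>\<^sub>H q) r"
          by (rule sup_mono) simp
        with q that show ?thesis
          by simp
      qed
      then have "top \<le> (INF r\<in>{r. {p, r} \<in> \<Theta>}. sup (p \<rightarrow>\<^sub>H q) r)"
        by (intro INF_greatest) simp
      ultimately have "top \<le> p \<rightarrow>\<^sub>H q"
        by (rule order_trans[rotated])
      then show "p \<le> q"
        by (simp only: le_himp_iff inf_top_left)
    qed
  qed
  then show ?thesis
    unfolding admissible_iff_pairs[OF assms] dominated_member_iff_pair[OF assms]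
    by (rule conj_cong[OF refl])
qed

end
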